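(* Let $n\ge1$, $\delta>0$ and $n<\beta<n+4$. Let $b\in H^{\sigma}(\mathbf{T}^n)$ with $\sigma\ge0$. Suppose that there exists $p\in\mathbb{Z}_{\ge0}$ such that $\sigma>n+(p-2)\frac{\beta-n}{2}$. Let $$u(x,t)=\hat b_0\frac{t^2}{2}+\sum_{0\ne k\in\mathbb{Z}^n}\frac{\hat b_k}{m_k}\left[\cos(\sqrt{-m_k}\,t)-1\right]e^{ik\cdot x}.$$ Then $u(x,\cdot)\in C^p[0,\infty)$ (in the sense of classical derivatives in $t$) for any $x\in\mathbf{T}^n$.
   Context: For $k\in\mathbb{Z}^n$, $m_k=m^{\delta,\beta}(k)$, where for $\nu\in\mathbb{R}^n$ $$m^{\delta,\beta}(\nu)=-\|\nu\|^2\,{}_2F_3\!\left(1,\tfrac{n+2-\beta}{2};2,\tfrac{n+2}{2},\tfrac{n+4-\beta}{2};-\tfrac14\|\nu\|^2\delta^2\right),$$ ${}_2F_3(a_1,a_2;b_1,b_2,b_3;z)=\sum_{j\ge0}\frac{(a_1)_j(a_2)_j}{(b_1)_j(b_2)_j(b_3)_j}\frac{z^j}{j!}$, $(a)_j=a(a+1)\cdots(a+j-1)$; for $\beta<n+4$ one has $m_k<0$ for all $k\neq0$. $\mathbf{T}^n=\prod_{j=1}^n[0,2\pi]$ is the periodic torus; a periodic distribution $g$ is written $g=\sum_{k\in\mathbb{Z}^n}\hat g_ke^{ik\cdot x}$ with Fourier coefficients $\hat g_k$; for $q\in\mathbb{R}$, $H^q(\mathbf{T}^n)$ is the space of periodic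 distributions with $\sum_{k\in\mathbb{Z}^n}(1+\|k\|^2)^q|\hat g_k|^2<\infty$. *)

theory Defs
  imports "HOL-Analysis.Analysis"
begin

text \<open>
  The dimension \<open>n\<close> is \<open>CARD('n)\<close>; frequencies are \<open>k :: int ^ 'n\<close>, points are \<open>x :: real ^ 'n\<close>.
\<close>

definition hyp2F3 :: "real \<Rightarrow> real \<Rightarrow> real \<Rightarrow> real \<Rightarrow> real \<Rightarrow> real \<Rightarrow> real" where
  "hyp2F3 a1 a2 b1 b2 b3 z =
     (\<Sum>j. (pochhammer a1 j * pochhammer a2 j) /
           (pochhammer b1 j * pochhammer b2 j * pochhammer b3 j) * (z ^ j / fact j))"

definition multiplier :: "real \<Rightarrow> real \<Rightarrow> real ^ 'n \<Rightarrow> real" where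
  "multiplier \<delta> \<beta> \<nu> = (let n = real CARD('n) in
     - (norm \<nu>)\<^sup>2 *
     hyp2F3 1 ((n + 2 - \<beta>) / 2) 2 ((n + 2) / 2) ((n + 4 - \<beta>) / 2)
       (- (1 / 4) * (norm \<nu>)\<^sup>2 * \<delta>\<^sup>2))"

definition real_vec :: "int ^ 'n \<Rightarrow> real ^ 'n" where
  "real_vec k = (\<chi> i. real_of_int (k $ i))"

definition torus :: "(real ^ 'n) set" where
  "torus = cbox 0 (\<chi> i. 2 * pi)"

definition fourier_mode :: "int ^ 'n \<Rightarrow> real ^ 'n \<Rightarrow> complex" where
  "fourier_mode k x = exp (\<i> * complex_of_real (real_vec k \<bullet> x))"


definition partial_deriv :: "'n \<Rightarrow> (real ^ 'n \<Rightarrow> complex) \<Rightarrow> real ^ 'n \<Rightarrow> complex" where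
  "partial_deriv i f x = vector_derivative (\<lambda>h. f (x + h *\<^sub>R axis i 1)) (at 0)"

definition iter_partial :: "'n list \<Rightarrow> (real ^ 'n \<Rightarrow> complex) \<Rightarrow> real ^ 'n \<Rightarrow> complex" where
  "iter_partial is f = foldr partial_deriv is f"

text \<open>
  Test functions are the \<open>2 * pi\<close>-periodic \<open>C\<close>-infinity functions. Requiring every iterated
  partial derivative to be (Frechet) differentiable makes all of them exist and be continuous.
\<close>

definition test_functions :: "(real ^ 'n \<Rightarrow> complex) set" where
  "test_functions = {\<phi>.
     (\<forall>x i. \<phi> (x + (2 * pi) *\<^sub>R axis i 1) = \<phi> x) \<and>
     (\<forall>is x. iter_partial is \<phi> differentiable (at x))}"

definition Ck_norm :: "nat \<Rightarrow> (real ^ 'n \<Rightarrow> complex) \<Rightarrow> real" where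
  "Ck_norm N \<phi> = (SUP (is, x) \<in> {is. length is \<le> N} \<times> UNIV. cmod (iter_partial is \<phi> x))"

text \<open>
  A periodic distribution is a linear functional on the test functions that is continuous for
  the topology given by the norms \<open>Ck_norm N\<close>. Its values outside the test functions are
  irrelevant.
\<close>

definition periodic_distribution :: "((real ^ 'n \<Rightarrow> complex) \<Rightarrow> complex) \<Rightarrow> bool" where
  "periodic_distribution g \<longleftrightarrow>
     (\<forall>\<phi>\<in>test_functions. \<forall>\<psi>\<in>test_functions. g (\<lambda>x. \<phi> x + \<psi> x) = g \<phi> + g \<psi>) \<and>
     (\<forall>\<phi>\<in>test_functions. \<forall>c. g (\<lambda>x. c * \<phi> x) = c * g \<phi>) \<and>
     (\<exists>C N. \<forall>\<phi>\<in>test_functions. cmod (g \<phi>) \<le> C * Ck_norm N \<phi>)"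

text \<open>
  The normalisation is the one for which \<open>g\<close> is the sum of
  \<open>fourier_coeff g k * fourier_mode k\<close> over all \<open>k\<close>, a function \<open>f\<close> being identified with
  the functional mapping \<open>\<phi>\<close> to the integral of \<open>f * \<phi>\<close> over the torus.
\<close>

definition fourier_coeff :: "((real ^ 'n \<Rightarrow> complex) \<Rightarrow> complex) \<Rightarrow> int ^ 'n \<Rightarrow> complex" where
  "fourier_coeff g k = g (fourier_mode (- k)) / of_real ((2 * pi) ^ CARD('n))"

definition sobolev_space :: "real \<Rightarrow> ((real ^ 'n \<Rightarrow> complex) \<Rightarrow> complex) set" where
  "sobolev_space q = {g. periodic_distribution g \<and>
     (\<lambda>k. (1 + (norm (real_vec k))\<^sup>2) powr q * (cmod (fourier_coeff g k))\<^sup>2) summable_on UNIV}"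


definition solution_term ::
  "real \<Rightarrow> real \<Rightarrow> ((real ^ 'n \<Rightarrow> complex) \<Rightarrow> complex) \<Rightarrow> real ^ 'n \<Rightarrow> real \<Rightarrow> int ^ 'n \<Rightarrow> complex"
where
  "solution_term \<delta> \<beta> b x t k = (let m = multiplier \<delta> \<beta> (real_vec k) in
     fourier_coeff b k / complex_of_real m *
     complex_of_real (cos (sqrt (- m) * t) - 1) * fourier_mode k x)"

definition solution ::
  "real \<Rightarrow> real \<Rightarrow> ((real ^ 'n \<Rightarrow> complex) \<Rightarrow> complex) \<Rightarrow> real ^ 'n \<Rightarrow> real \<Rightarrow> complex"
where
  "solution \<delta> \<beta> b x t =
     fourier_coeff b 0 * complex_of_real (t\<^sup>2 / 2) +
     (\<Sum>\<^sub>\<infinity>k\<in>{k. k \<noteq> 0}. solution_term \<delta> \<beta> b x t k)"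


text \<open>
  \<open>D j\<close> is the \<open>j\<close>-th derivative; derivatives are taken within \<open>S\<close>, hence one-sided at an
  endpoint of an interval \<open>S\<close>.
\<close>

definition Cp_on :: "nat \<Rightarrow> real set \<Rightarrow> (real \<Rightarrow> complex) \<Rightarrow> bool" where
  "Cp_on p S f \<longleftrightarrow> (\<exists>D :: nat \<Rightarrow> real \<Rightarrow> complex.
     (\<forall>t\<in>S. D 0 t = f t) \<and>
     (\<forall>j<p. \<forall>t\<in>S. (D j has_vector_derivative D (Suc j) t) (at t within S)) \<and>
     (\<forall>j\<le>p. continuous_on S (D j)))"

end

theory Submission
  imports Defs
begin

text \<open>
  With \<open>h = n / 2\<close>, \<open>a = (n + 2 - \<beta>) / 2\<close> and \<open>w = (norm \<nu> * \<delta>)\<^sup>2\<close> the multiplier is \<open>- (norm \<nu>)\<^sup>2 F w\<close>,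
  where \<open>(w\<^sup>a F w)' = 4 a h w\<^sup>a\<^sup>-\<^sup>2 (1 - g w)\<close> and \<open>g\<close> is a Bessel-type entire function solving
  \<open>w g'' + h g' = - g / 4\<close>, \<open>g 0 = 1\<close>. This equation gives \<open>\<bar>g w\<bar> \<le> 1\<close> and \<open>g w \<ge> 1 - w / (4 h)\<close>, and these
  inequalities make \<open>w\<^sup>a F w\<close>, up to explicit powers of \<open>w\<close>, monotone. For large \<open>w\<close> it stays between two positive
  constants, and \<open>\<bar>m\<^sub>k\<bar>\<close> is comparable to \<open>norm k powr (\<beta> - n)\<close>. The \<open>j\<close>-th time derivative
  of a term of the series is at most \<open>2 \<bar>b\<^sub>k\<bar> (\<bar>m\<^sub>k\<bar> powr (j / 2 - 1))\<close>, and the condition on \<open>\<sigma>\<close> is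
  what makes this summable over the lattice, already when \<open>(norm k)\<^sup>\<sigma> \<bar>b\<^sub>k\<bar>\<close> is merely bounded.
\<close>

subsection \<open>Growth of the multiplier\<close>

lemma powser_summable_if_le_inverse_fact:
  fixes c :: "nat \<Rightarrow> real"
  assumes "\<And>j. j \<ge> N \<Longrightarrow> \<bar>c j\<bar> \<le> C / fact j"
  shows "summable (\<lambda>j. c j * w ^ j)"
proof (rule summable_comparison_test')
  show "summable (\<lambda>j. C * (inverse (fact j) * \<bar>w\<bar> ^ j))"
    using summable_exp[of "\<bar>w\<bar>"] by (rule summable_mult)
  fix j assume "j \<ge> N"
  then have "\<bar>c j\<bar> * \<bar>w\<bar> ^ j \<le> C / fact j * \<bar>w\<bar> ^ j"
    using assms by (intro mult_right_mono) auto
  then show "norm (c j * w ^ j) \<le> C * (inverse (fact j) * \<bar>w\<bar> ^ j)"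
    by (simp add: abs_mult power_abs divide_inverse mult_ac)
qed

text \<open>The operator \<open>r + w d/dw\<close> multiplies \<open>w ^ j\<close> by
  \<open>r + j\<close>, so recurrences between coefficients become differential equations.\<close>

lemma powser_euler_sums:
  fixes c :: "nat \<Rightarrow> real"
  assumes "\<And>w. summable (\<lambda>j. c j * w ^ j)"
  shows "(\<lambda>j. (r + real j) * c j * w ^ j) sums (r * (\<Sum>j. c j * w ^ j) + w * (\<Sum>j. diffs c j * w ^ j))"
proof -
  have "(\<lambda>j. of_nat j * c j * w ^ (j - Suc 0)) sums (\<Sum>j. diffs c j * w ^ j)"
    using assms by (intro diffs_equiv termdiff_converges_all)
  then have "(\<lambda>j. w * (of_nat j * c j * w ^ (j - Suc 0))) sums (w * (\<Sum>j. diffs c j * w ^ j))"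
    by (rule sums_mult)
  moreover have "w * (of_nat j * c j * w ^ (j - Suc 0)) = real j * c j * w ^ j" for j
    by (cases j) auto
  ultimately have "(\<lambda>j. real j * c j * w ^ j) sums (w * (\<Sum>j. diffs c j * w ^ j))"
    by simp
  moreover have "(\<lambda>j. r * (c j * w ^ j)) sums (r * (\<Sum>j. c j * w ^ j))"
    using assms by (intro sums_mult summable_sums)
  ultimately have "(\<lambda>j. r * (c j * w ^ j) + real j * c j * w ^ j) sums
      (r * (\<Sum>j. c j * w ^ j) + w * (\<Sum>j. diffs c j * w ^ j))"
    by (intro sums_add)
  then show ?thesis
    by (simp add: algebra_simps)
qed

section \<open>The Bessel-type function \<open>g\<close> and its differential equation\<close>

text \<open>For \<open>h = n / 2\<close>, \<open>bessel_fun h (r\<^sup>2)\<close> is the mean of \<open>exp (\<i> y \<bullet> x)\<close> over the sphere \<open>norm x = r\<close> in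
  dimension \<open>n\<close>, with \<open>y\<close> a unit vector. It is handled through its differential equation only.\<close>

definition bessel_coeff :: "real \<Rightarrow> nat \<Rightarrow> real" where
  "bessel_coeff h j = (- (1 / 4)) ^ j / (pochhammer h j * fact j)"

definition bessel_fun :: "real \<Rightarrow> real \<Rightarrow> real" where
  "bessel_fun h w = (\<Sum>j. bessel_coeff h j * w ^ j)"

definition bessel_fun' :: "real \<Rightarrow> real \<Rightarrow> real" where
  "bessel_fun' h w = (\<Sum>j. diffs (bessel_coeff h) j * w ^ j)"

text \<open>Every factor \<open>h + i\<close> is at least 1/2. This crude bound suffices because
  \<open>bessel_coeff\<close> carries the factor \<open>(1 / 4) ^ j\<close> in absolute
  value.\<close>

lemma pochhammer_ge_half_power:
  assumes "h \<ge> (1 / 2 :: real)"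
  shows "pochhammer h j \<ge> (1 / 2) ^ j"
proof (induction j)
  case (Suc j)
  have "(1 / 2) ^ j * (1 / 2) \<le> pochhammer h j * (h + real j)"
    using Suc assms by (intro mult_mono order_less_imp_le[OF pochhammer_pos]) auto
  then show ?case
    by (simp add: pochhammer_Suc)
qed simp

lemma bessel_coeff_0 [simp]: "bessel_coeff h 0 = 1"
  by (simp add: bessel_coeff_def)

lemma abs_bessel_coeff_le:
  assumes "h \<ge> 1 / 2"
  shows "\<bar>bessel_coeff h j\<bar> \<le> 1 / fact j"
proof -
  have p: "pochhammer h j \<ge> (1 / 2) ^ j"
    using assms by (rule pochhammer_ge_half_power)
  moreover have "(1 / 4 :: real) ^ j \<le> (1 / 2) ^ j"
    by (intro power_mono) auto
  moreover have "(0::real) < (1 / 2) ^ j"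
    by simp
  ultimately have "(1 / 4) ^ j \<le> pochhammer h j" "pochhammer h j > 0"
    by linarith+
  then show ?thesis
    by (simp add: bessel_coeff_def abs_mult power_abs abs_divide field_simps)
qed

lemma summable_bessel_coeff:
  assumes "h \<ge> 1 / 2"
  shows "summable (\<lambda>j. bessel_coeff h j * w ^ j)"
  by (rule powser_summable_if_le_inverse_fact) (rule abs_bessel_coeff_le[OF assms])

text \<open>Coefficient form of the equation \<open>w g'' + h g' = - g / 4\<close>.\<close>

lemma bessel_coeff_Suc:
  assumes "h \<ge> 1 / 2"
  shows "(h + real j) * diffs (bessel_coeff h) j = - bessel_coeff h j / 4"
proof -
  have "pochhammer h j > 0" "h + real j > 0"
    using assms by (auto intro!: pochhammer_pos)
  then show ?thesis
    unfolding diffs_def bessel_coeff_def pochhammer_Suc fact_Suc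
    by (simp add: divide_simps)
qed

lemma bessel_fun_0 [simp]: "bessel_fun h 0 = 1"
  unfolding bessel_fun_def by (subst powser_zero) simp

lemma bessel_fun_deriv:
  assumes "h \<ge> 1 / 2"
  shows "(bessel_fun h has_real_derivative bessel_fun' h w) (at w)"
  unfolding bessel_fun_def bessel_fun'_def
  using summable_bessel_coeff[OF assms] by (rule termdiffs_strong_converges_everywhere)

text \<open>Apply \<open>powser_euler_sums\<close> with \<open>r = h\<close> to the series of
  \<open>g'\<close>. Only the product \<open>w * g''\<close> is recorded, since the later arguments
  use \<open>g''\<close> through the equation alone.\<close>

lemma bessel_fun'_deriv:
  assumes "h \<ge> 1 / 2"
  obtains g'' where
    "(bessel_fun' h has_real_derivative g'') (at w)"
    "w * g'' = - bessel_fun h w / 4 - h * bessel_fun' h w"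
proof
  let ?e = "diffs (bessel_coeff h)"
  have s: "summable (\<lambda>j. ?e j * w ^ j)" for w
    using summable_bessel_coeff[OF assms] by (intro termdiff_converges_all)
  show "(bessel_fun' h has_real_derivative (\<Sum>j. diffs ?e j * w ^ j)) (at w)"
    unfolding bessel_fun'_def using s by (rule termdiffs_strong_converges_everywhere)
  have "(\<lambda>j. (h + real j) * ?e j * w ^ j) sums (h * bessel_fun' h w + w * (\<Sum>j. diffs ?e j * w ^ j))"
    unfolding bessel_fun'_def using s by (rule powser_euler_sums)
  moreover have "(\<lambda>j. (- 1 / 4) * (bessel_coeff h j * w ^ j)) sums ((- 1 / 4) * bessel_fun h w)"
    unfolding bessel_fun_def by (intro sums_mult summable_sums summable_bessel_coeff[OF assms])
  ultimately have "h * bessel_fun' h w + w * (\<Sum>j. diffs ?e j * w ^ j) = (- 1 / 4) * bessel_fun h w"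
    by (simp add: bessel_coeff_Suc[OF assms] sums_unique2)
  then show "w * (\<Sum>j. diffs ?e j * w ^ j) = - bessel_fun h w / 4 - h * bessel_fun' h w"
    by (simp add: algebra_simps)
qed

text \<open>The energy \<open>g\<^sup>2 + 4 w g'\<^sup>2\<close> has derivative \<open>(4 - 8 h) g'\<^sup>2\<close> by the equation \<open>w g'' + h g' = - g / 4\<close>.\<close>

lemma abs_bessel_fun_le_1:
  assumes "h \<ge> 1 / 2" "w \<ge> 0"
  shows "\<bar>bessel_fun h w\<bar> \<le> 1"
proof -
  define E where "E w = (bessel_fun h w)\<^sup>2 + 4 * w * (bessel_fun' h w)\<^sup>2" for w
  have "\<exists>y. (E has_real_derivative y) (at v) \<and> y \<le> 0" for v
  proof -
    obtain g'' where g'': "(bessel_fun' h has_real_derivative g'') (at v)"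
      "v * g'' = - bessel_fun h v / 4 - h * bessel_fun' h v"
      using bessel_fun'_deriv[OF assms(1)] .
    have "(E has_real_derivative (2 * bessel_fun h v * bessel_fun' h v + 4 * (bessel_fun' h v)\<^sup>2
        + 8 * bessel_fun' h v * (v * g''))) (at v)"
      unfolding E_def
      by (rule derivative_eq_intros bessel_fun_deriv[OF assms(1)] g'' refl | simp)+
    moreover have "2 * bessel_fun h v * bessel_fun' h v + 4 * (bessel_fun' h v)\<^sup>2
        + 8 * bessel_fun' h v * (v * g'') = (4 - 8 * h) * (bessel_fun' h v)\<^sup>2"
      unfolding g''(2) by (simp add: algebra_simps power2_eq_square)
    ultimately show ?thesis
      using assms(1) by (auto intro!: mult_nonpos_nonneg)
  qed
  then have "E w \<le> E 0"
    using assms(2) by (intro DERIV_nonpos_imp_nonincreasing[of 0 w E]) auto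
  then have "(bessel_fun h w)\<^sup>2 + 4 * w * (bessel_fun' h w)\<^sup>2 \<le> 1"
    by (simp add: E_def)
  moreover have "4 * w * (bessel_fun' h w)\<^sup>2 \<ge> 0"
    using assms(2) by simp
  ultimately have "(bessel_fun h w)\<^sup>2 \<le> 1"
    by linarith
  then show ?thesis
    by (simp add: abs_square_le_1)
qed

text \<open>With \<open>P = g' + 1 / (4 h)\<close> the equation reads \<open>(w\<^sup>h P)' = w\<^sup>h\<^sup>-\<^sup>1 (1 - g) / 4 \<ge> 0\<close>.\<close>

lemma bessel_fun_ge:
  assumes "h \<ge> 1 / 2" "w \<ge> 0"
  shows "bessel_fun h w \<ge> 1 - w / (4 * h)"
proof -
  have P_nonneg: "bessel_fun' h w + 1 / (4 * h) \<ge> 0" if "w > 0" for w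
  proof -
    define Q where "Q v = v powr h * (bessel_fun' h v + 1 / (4 * h))" for v
    have "\<exists>y. (Q has_real_derivative y) (at v) \<and> y \<ge> 0" if "v > 0" for v
    proof -
      obtain g'' where g'': "(bessel_fun' h has_real_derivative g'') (at v)"
        "v * g'' = - bessel_fun h v / 4 - h * bessel_fun' h v"
        using bessel_fun'_deriv[OF assms(1)] .
      have "(Q has_real_derivative (h * v powr (h - 1) * (bessel_fun' h v + 1 / (4 * h))
          + g'' * v powr h)) (at v)"
        unfolding Q_def using that
        by (auto intro!: derivative_eq_intros g'')
      moreover have "h * v powr (h - 1) * (bessel_fun' h v + 1 / (4 * h)) + g'' * v powr h
          = v powr (h - 1) * (h * bessel_fun' h v + 1 / 4 + v * g'')"
        using that assms(1) powr_mult_base[of v "h - 1"] by (simp add: field_simps)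
      moreover have "\<dots> = v powr (h - 1) * ((1 - bessel_fun h v) / 4)"
        unfolding g''(2) by (simp add: field_simps)
      ultimately show ?thesis
        using abs_bessel_fun_le_1[of h v] assms(1) that by auto
    qed
    moreover have "continuous_on {0..w} (bessel_fun' h)"
    proof (intro continuous_at_imp_continuous_on ballI)
      show "isCont (bessel_fun' h) v" for v
        by (rule bessel_fun'_deriv[OF assms(1), of v]) (rule DERIV_isCont)
    qed
    then have "continuous_on {0..w} Q"
      unfolding Q_def using assms(1)
      by (intro continuous_intros continuous_on_powr') auto
    \<comment> \<open>The power \<open>v powr h\<close> is differentiated for \<open>v > 0\<close>
      only, so the left end point enters by continuity; there \<open>0 powr h = 0\<close> gives
      \<open>Q 0 = 0\<close>.\<close>
    ultimately have "Q 0 \<le> Q w"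
      using \<open>w > 0\<close> by (intro DERIV_nonneg_imp_increasing_open[of 0 w Q]) auto
    then show ?thesis
      using \<open>w > 0\<close> assms(1) by (simp add: Q_def zero_le_mult_iff)
  qed
  \<comment> \<open>The quantity just shown to be nonnegative is the derivative of
    \<open>g + v / (4 h)\<close>, whose value at 0 is 1.\<close>
  have "((\<lambda>v. bessel_fun h v + v / (4 * h)) has_real_derivative
      bessel_fun' h v + 1 / (4 * h)) (at v)" for v
    by (intro DERIV_add DERIV_cdivide DERIV_ident bessel_fun_deriv[OF assms(1)])
  then have "bessel_fun h 0 + 0 / (4 * h) \<le> bessel_fun h w + w / (4 * h)"
    using assms(2) P_nonneg
    by (intro DERIV_nonneg_imp_increasing_open[of 0 w "\<lambda>v. bessel_fun h v + v / (4 * h)"]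
        continuous_at_imp_continuous_on ballI) (blast intro: DERIV_isCont)+
  then show ?thesis
    by simp
qed

section \<open>The hypergeometric function and its first-order equation\<close>

definition hyp_coeff :: "real \<Rightarrow> real \<Rightarrow> nat \<Rightarrow> real" where
  "hyp_coeff h a j = (pochhammer 1 j * pochhammer a j) /
     (pochhammer 2 j * pochhammer (h + 1) j * pochhammer (a + 1) j) * ((- (1 / 4)) ^ j / fact j)"

text \<open>The factor -1/4 of the argument sits in \<open>hyp_coeff\<close>, so that the variable
  is \<open>w\<close> itself.\<close>

definition hyp_fun :: "real \<Rightarrow> real \<Rightarrow> real \<Rightarrow> real" where
  "hyp_fun h a w = (\<Sum>j. hyp_coeff h a j * w ^ j)"

lemma hyp2F3_eq_hyp_fun: "hyp2F3 1 a 2 (h + 1) (a + 1) (- (1 / 4) * w) = hyp_fun h a w"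
  unfolding hyp2F3_def hyp_fun_def hyp_coeff_def power_mult_distrib by (simp add: mult.assoc)

lemma hyp_coeff_0 [simp]: "hyp_coeff h a 0 = 1"
  by (simp add: hyp_coeff_def)

lemma hyp_fun_0 [simp]: "hyp_fun h a 0 = 1"
  unfolding hyp_fun_def by (subst powser_zero) simp

text \<open>Upper and lower parameters that differ by 1 telescope: the pair \<open>1, 2\<close>
  leaves \<open>1 / (j + 1)\<close>, the pair \<open>a, a + 1\<close> leaves
  \<open>a / (a + j)\<close>. The identity is multiplied out because \<open>a + j\<close> vanishes
  for \<open>a = 0\<close>, \<open>j = 0\<close>.\<close>

lemma hyp_coeff_eq_bessel_coeff:
  assumes "h \<ge> 1 / 2" "a > - 1"
  shows "(a + real j) * hyp_coeff h a j = - 4 * a * h * bessel_coeff h (Suc j)"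
proof -
  have a: "pochhammer a j * (a + real j) = a * pochhammer (a + 1) j"
    using pochhammer_rec[of a j] pochhammer_Suc[of a j] by simp
  have "pochhammer (2::real) j = fact (Suc j)"
    using pochhammer_rec[of "1::real" j] by (simp add: pochhammer_fact)
  moreover have "pochhammer 1 j = (fact j :: real)"
    by (simp add: pochhammer_fact)
  moreover have "pochhammer h (Suc j) = h * pochhammer (h + 1) j"
    by (rule pochhammer_rec)
  moreover have "pochhammer (a + 1) j > 0" "pochhammer (h + 1) j > 0"
    using assms by (auto intro!: pochhammer_pos)
  ultimately show ?thesis
    using a assms unfolding hyp_coeff_def bessel_coeff_def
    by (simp add: divide_simps mult.commute del: fact_Suc)
qed

lemma summable_hyp_coeff:
  assumes "h \<ge> 1 / 2" "a > - 1"
  shows "summable (\<lambda>j. hyp_coeff h a j * w ^ j)"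
proof (rule powser_summable_if_le_inverse_fact)
  \<comment> \<open>From \<open>j = 2\<close> on, \<open>a > - 1\<close> gives
    \<open>a + j \<ge> 1\<close>.\<close>
  fix j :: nat assume "j \<ge> 2"
  then have "\<bar>hyp_coeff h a j\<bar> * 1 \<le> \<bar>hyp_coeff h a j\<bar> * (a + real j)"
    using assms by (intro mult_left_mono) auto
  also have "\<dots> = \<bar>(a + real j) * hyp_coeff h a j\<bar>"
    using \<open>j \<ge> 2\<close> assms by (simp add: abs_mult)
  also have "\<dots> = \<bar>4 * a * h\<bar> * \<bar>bessel_coeff h (Suc j)\<bar>"
    by (simp add: hyp_coeff_eq_bessel_coeff[OF assms] abs_mult)
  also have "\<dots> \<le> \<bar>4 * a * h\<bar> * (1 / fact (Suc j))"
    by (intro mult_left_mono abs_bessel_coeff_le assms) auto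
  also have "\<dots> \<le> \<bar>4 * a * h\<bar> * (1 / fact j)"
    by (intro mult_left_mono frac_le fact_mono) auto
  finally show "\<bar>hyp_coeff h a j\<bar> \<le> \<bar>4 * a * h\<bar> / fact j"
    by simp
qed

text \<open>By \<open>powser_euler_sums\<close> with \<open>r = a\<close>, the series of
  \<open>a F + w F'\<close> has the Bessel coefficients with index raised by one; the extra factor
  \<open>w\<close> realigns the powers and yields \<open>g\<close> without its constant
  term.\<close>

lemma hyp_fun_deriv:
  assumes "h \<ge> 1 / 2" "a > - 1"
  obtains F' where
    "(hyp_fun h a has_real_derivative F') (at w)"
    "w * (a * hyp_fun h a w + w * F') = 4 * a * h * (1 - bessel_fun h w)"
proof
  let ?F' = "\<Sum>j. diffs (hyp_coeff h a) j * w ^ j"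
  show "(hyp_fun h a has_real_derivative ?F') (at w)"
    unfolding hyp_fun_def
    using summable_hyp_coeff[OF assms] by (rule termdiffs_strong_converges_everywhere)
  have "(\<lambda>j. (a + real j) * hyp_coeff h a j * w ^ j) sums (a * hyp_fun h a w + w * ?F')"
    unfolding hyp_fun_def using summable_hyp_coeff[OF assms] by (rule powser_euler_sums)
  from sums_mult[OF this, of w]
  have "(\<lambda>j. (- 4 * a * h) * (bessel_coeff h (Suc j) * w ^ Suc j))
      sums (w * (a * hyp_fun h a w + w * ?F'))"
    unfolding hyp_coeff_eq_bessel_coeff[OF assms] by (simp add: mult_ac)
  moreover have "(\<lambda>j. bessel_coeff h (Suc j) * w ^ Suc j) sums (bessel_fun h w - 1)"
    using summable_sums[OF summable_bessel_coeff[OF assms(1)], of w]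
    by (subst sums_Suc_iff) (simp add: bessel_fun_def)
  then have "(\<lambda>j. (- 4 * a * h) * (bessel_coeff h (Suc j) * w ^ Suc j))
      sums ((- 4 * a * h) * (bessel_fun h w - 1))"
    by (rule sums_mult)
  ultimately have "w * (a * hyp_fun h a w + w * ?F') = (- 4 * a * h) * (bessel_fun h w - 1)"
    by (rule sums_unique2)
  then show "w * (a * hyp_fun h a w + w * ?F') = 4 * a * h * (1 - bessel_fun h w)"
    by (simp add: algebra_simps)
qed

lemma powr_hyp_fun_deriv:
  assumes "h \<ge> 1 / 2" "a > - 1" "w > 0"
  shows "((\<lambda>w. w powr a * hyp_fun h a w) has_real_derivative
    w powr (a - 2) * (4 * a * h * (1 - bessel_fun h w))) (at w)"
proof -
  obtain F' where F': "(hyp_fun h a has_real_derivative F') (at w)"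
    "w * (a * hyp_fun h a w + w * F') = 4 * a * h * (1 - bessel_fun h w)"
    using hyp_fun_deriv[OF assms(1,2)] .
  have p: "w powr (a - 1) = w * w powr (a - 2)" "w powr a = w * (w * w powr (a - 2))"
    using assms(3) powr_mult_base[of w "a - 2"] powr_mult_base[of w "a - 1"] by auto
  have "((\<lambda>w. w powr a * hyp_fun h a w) has_real_derivative
      (a * w powr (a - 1) * hyp_fun h a w + F' * w powr a)) (at w)"
    using assms(3) by (auto intro!: derivative_eq_intros F'(1))
  also have "a * w powr (a - 1) * hyp_fun h a w + F' * w powr a
      = w powr (a - 2) * (w * (a * hyp_fun h a w + w * F'))"
    unfolding p by (simp add: algebra_simps)
  finally show ?thesis
    unfolding F'(2) .
qed

text \<open>
  The function \<open>K w = w\<^sup>a F w\<close> satisfies \<open>K' w = 4 a h w\<^sup>a\<^sup>-\<^sup>2 (1 - g w)\<close>. For \<open>a > 0\<close>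
  monotonicity of \<open>K\<close> gives the lower bound, and adding a multiple of \<open>w\<^sup>a\<^sup>-\<^sup>1\<close> makes it
  decreasing; for \<open>a < 0\<close> the function \<open>K\<close> itself decreases, while \<open>K w - w\<^sup>a\<close> increases.
\<close>

lemma hyp_fun_bounds:
  assumes "h \<ge> 1 / 2" "- 1 < a" "a < 1"
  obtains w0 c C where "w0 > 0" "c > 0"
    "\<And>w. w \<ge> w0 \<Longrightarrow> c \<le> w powr a * hyp_fun h a w"
    "\<And>w. w \<ge> w0 \<Longrightarrow> w powr a * hyp_fun h a w \<le> C"
proof -
  define K where "K w = w powr a * hyp_fun h a w" for w
  have K_deriv: "(K has_real_derivative w powr (a - 2) * (4 * a * h * (1 - bessel_fun h w))) (at w)"
    if "w > 0" for w
    unfolding K_def using assms that by (intro powr_hyp_fun_deriv)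
  have g_le: "bessel_fun h w \<le> 1" and g_ge: "- 1 \<le> bessel_fun h w"
    and g_ge': "1 - w / (4 * h) \<le> bessel_fun h w" if "w > 0" for w
    using abs_bessel_fun_le_1[of h w] bessel_fun_ge[of h w] assms that by auto
  have powr_deriv: "((\<lambda>w. w powr s) has_real_derivative s * w powr (s - 1)) (at w)"
    if "w > 0" for s w :: real
    using that by (auto intro!: derivative_eq_intros)
  consider "a > 0" | "a = 0" | "a < 0"
    by linarith
  then show ?thesis
  proof cases
    case 1
    \<comment> \<open>Since \<open>F 0 = 1\<close>, some \<open>w0 > 0\<close> has
      \<open>F w0 > 0\<close>; the increasing \<open>K\<close> then stays above
      \<open>K w0 > 0\<close>.\<close>
    have "isCont (hyp_fun h a) 0"
      by (rule hyp_fun_deriv[OF assms(1,2), of 0]) (rule DERIV_isCont)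
    then have "eventually (\<lambda>w. hyp_fun h a w > 0) (at_right 0)"
      unfolding isCont_def
      by (intro order_tendstoD[where y = 1]) (auto intro: filterlim_at_split[THEN iffD1, THEN conjunct2])
    then have "eventually (\<lambda>w::real. hyp_fun h a w > 0 \<and> w > 0) (at_right 0)"
      using eventually_at_right_less by (rule eventually_conj)
    then obtain w0 :: real where w0: "w0 > 0" "hyp_fun h a w0 > 0"
      by (metis (no_types, lifting) eventually_happens trivial_limit_at_right_real)
    \<comment> \<open>With \<open>B * (a - 1) = - 8 * a * h\<close> the factor \<open>1 - g\<close>
      in \<open>K'\<close> becomes \<open>- (1 + g)\<close> in \<open>U'\<close>, which is
      nonpositive.\<close>
    define B where "B = 8 * a * h / (1 - a)"
    define U where "U w = K w + B * w powr (a - 1)" for w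
    have "B \<ge> 0"
      using 1 assms by (auto simp: B_def)
    show ?thesis
    proof
      show "w0 > 0" by fact
      show "K w0 > 0"
        using w0 by (simp add: K_def)
      fix w assume w: "w \<ge> w0"
      show "K w0 \<le> w powr a * hyp_fun h a w"
        unfolding K_def[of w, symmetric]
      proof (rule DERIV_nonneg_imp_nondecreasing[OF w])
        fix v assume "w0 \<le> v"
        then show "\<exists>y. (K has_real_derivative y) (at v) \<and> y \<ge> 0"
          using K_deriv[of v] g_le[of v] 1 assms w0(1)
          by (intro exI conjI) (assumption | auto)+
      qed
      have "U w \<le> U w0"
      proof (rule DERIV_nonpos_imp_nonincreasing[OF w])
        fix v assume "w0 \<le> v"
        then have v: "v > 0"
          using w0(1) by simp
        have "(U has_real_derivative v powr (a - 2) * (4 * a * h * (1 - bessel_fun h v))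
            + B * ((a - 1) * v powr (a - 1 - 1))) (at v)"
          unfolding U_def by (intro DERIV_add DERIV_cmult K_deriv powr_deriv v)
        moreover have B: "B * (a - 1) = - 8 * a * h"
          using assms by (simp add: B_def field_simps)
        have "v powr (a - 2) * (4 * a * h * (1 - bessel_fun h v)) + B * ((a - 1) * v powr (a - 1 - 1))
            = v powr (a - 2) * (4 * a * h * (1 - bessel_fun h v) + B * (a - 1))"
          by (simp add: algebra_simps)
        then have "v powr (a - 2) * (4 * a * h * (1 - bessel_fun h v)) + B * ((a - 1) * v powr (a - 1 - 1))
            = - (v powr (a - 2) * (4 * a * h * (1 + bessel_fun h v)))"
          unfolding B by (simp add: algebra_simps)
        ultimately show "\<exists>y. (U has_real_derivative y) (at v) \<and> y \<le> 0"
          using g_ge[OF v] 1 assms by (intro exI conjI) (assumption | simp)+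
      qed
      then show "w powr a * hyp_fun h a w \<le> U w0"
        unfolding K_def[of w, symmetric] U_def[of w]
        using \<open>B \<ge> 0\<close> by (smt (verit) mult_nonneg_nonneg powr_ge_zero)
    qed
  next
    case 2
    have "hyp_coeff h a j * w ^ j = 0" if "j \<noteq> 0" for j w
      using that 2 by (simp add: hyp_coeff_def pochhammer_0_left)
    then have "hyp_fun h a w = 1" for w
      unfolding hyp_fun_def using suminf_finite[of "{0}" "\<lambda>j. hyp_coeff h a j * w ^ j"] by simp
    then show ?thesis
      using 2 that[of 1 1 1] by simp
  next
    case 3
    \<comment> \<open>The lower bound will be \<open>L w0 = w0 powr a * (F w0 - 1)\<close>, so a
      point with \<open>F w0 > 1\<close> is needed. It exists because \<open>F 0 = 1\<close> and the
      first coefficient, that is \<open>F' 0\<close>, is positive.\<close>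
    have "(\<lambda>w. \<Sum>j. hyp_coeff h a j * w ^ j) = hyp_fun h a"
      by (simp add: hyp_fun_def fun_eq_iff)
    then have "(hyp_fun h a has_real_derivative (\<Sum>j. diffs (hyp_coeff h a) j * 0 ^ j)) (at 0)"
      using termdiffs_strong_converges_everywhere[OF summable_hyp_coeff[OF assms(1,2)]] by metis
    then have "(hyp_fun h a has_real_derivative hyp_coeff h a 1) (at 0)"
      by (subst (asm) powser_zero) (simp add: diffs_def)
    moreover have "hyp_coeff h a 1 > 0"
    proof -
      have "bessel_coeff h 2 > 0"
        using assms by (simp add: bessel_coeff_def pochhammer_Suc numeral_2_eq_2)
      then have "- 4 * a * h * bessel_coeff h 2 > 0"
        using 3 assms by (intro mult_pos_pos[OF mult_pos_pos]) auto
      then have "(a + 1) * hyp_coeff h a 1 > 0"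
        using hyp_coeff_eq_bessel_coeff[OF assms(1,2), of 1] by (simp add: numeral_2_eq_2)
      then show ?thesis
        using assms by (simp add: zero_less_mult_iff)
    qed
    ultimately obtain d where d: "d > 0" "\<And>e. 0 < e \<Longrightarrow> e < d \<Longrightarrow> hyp_fun h a 0 < hyp_fun h a (0 + e)"
      using DERIV_pos_inc_right by metis
    define w0 where "w0 = d / 2"
    have w0: "w0 > 0" "hyp_fun h a w0 > 1"
      using d(1) d(2)[of w0] by (auto simp: w0_def)
    define L where "L w = K w - w powr a" for w
    show ?thesis
    proof
      show "w0 > 0" by fact
      show "L w0 > 0"
        using w0 by (simp add: L_def K_def)
      fix w assume w: "w \<ge> w0"
      show "w powr a * hyp_fun h a w \<le> K w0"
        unfolding K_def[of w, symmetric]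
      proof (rule DERIV_nonpos_imp_nonincreasing[OF w])
        fix v assume "w0 \<le> v"
        then have v: "v > 0"
          using w0(1) by simp
        have "4 * a * h * (1 - bessel_fun h v) \<le> 0"
          using g_le[OF v] 3 assms by (intro mult_nonpos_nonneg[OF mult_nonpos_nonneg]) auto
        then have "v powr (a - 2) * (4 * a * h * (1 - bessel_fun h v)) \<le> 0"
          by (rule mult_nonneg_nonpos[OF powr_ge_zero])
        then show "\<exists>y. (K has_real_derivative y) (at v) \<and> y \<le> 0"
          using K_deriv[OF v] by blast
      qed
      have "L w0 \<le> L w"
      proof (rule DERIV_nonneg_imp_nondecreasing[OF w])
        fix v assume "w0 \<le> v"
        then have v: "v > 0"
          using w0(1) by simp
        have "(L has_real_derivative v powr (a - 2) * (4 * a * h * (1 - bessel_fun h v))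
            - a * v powr (a - 1)) (at v)"
          unfolding L_def by (intro DERIV_diff K_deriv powr_deriv v)
        moreover have "v powr (a - 1) = v * v powr (a - 2)"
          using v powr_mult_base[of v "a - 2"] by simp
        \<comment> \<open>The subtracted power turns \<open>1 - g\<close> into the gap in the bound
          \<open>g \<ge> 1 - v / (4 h)\<close>, so \<open>L\<close> increases.\<close>
        then have "v powr (a - 2) * (4 * a * h * (1 - bessel_fun h v)) - a * v powr (a - 1)
            = v powr (a - 2) * ((- a) * (4 * h) * (bessel_fun h v - (1 - v / (4 * h))))"
          using assms by (simp add: field_simps)
        moreover have "v powr (a - 2) * ((- a) * (4 * h) * (bessel_fun h v - (1 - v / (4 * h)))) \<ge> 0"
          using g_ge'[OF v] 3 assms by (intro mult_nonneg_nonneg) auto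
        ultimately show "\<exists>y. (L has_real_derivative y) (at v) \<and> y \<ge> 0"
          by metis
      qed
      then show "L w0 \<le> w powr a * hyp_fun h a w"
        unfolding K_def[of w, symmetric] L_def[of w]
        by (smt (verit) powr_ge_zero)
    qed
  qed
qed

text \<open>As \<open>w powr a * F w\<close> lies between positive constants,
  \<open>(norm \<nu>)\<^sup>2 * F w\<close> has the order of \<open>(norm \<nu>)\<^sup>2\<close> to
  the power \<open>1 - a\<close>, which is \<open>(\<beta> - n) / 2\<close>. The base
  \<open>1 + (norm \<nu>)\<^sup>2\<close> matches the Sobolev weight.\<close>

lemma multiplier_bounds:
  fixes \<delta> \<beta> :: real
  assumes "\<delta> > 0" "real CARD('n::finite) < \<beta>" "\<beta> < real CARD('n) + 4"
  obtains R c C where "c > 0"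
    "\<And>\<nu> :: real^'n. norm \<nu> \<ge> R \<Longrightarrow>
      c * (1 + (norm \<nu>)\<^sup>2) powr ((\<beta> - real CARD('n)) / 2) \<le> \<bar>multiplier \<delta> \<beta> \<nu>\<bar>"
    "\<And>\<nu> :: real^'n. norm \<nu> \<ge> R \<Longrightarrow>
      \<bar>multiplier \<delta> \<beta> \<nu>\<bar> \<le> C * (1 + (norm \<nu>)\<^sup>2) powr ((\<beta> - real CARD('n)) / 2)"
proof -
  define s where "s = (\<beta> - real CARD('n)) / 2"
  define h where "h = real CARD('n) / 2"
  define a where "a = (real CARD('n) + 2 - \<beta>) / 2"
  have s: "s > 0" and a: "- 1 < a" "a < 1" and s_eq: "s = 1 - a"
    using assms by (auto simp: s_def a_def field_simps)
  have "CARD('n) \<ge> 1"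
    by (simp add: Suc_le_eq)
  then have h: "h \<ge> 1 / 2"
    by (simp add: h_def)
  have mult: "multiplier \<delta> \<beta> \<nu> = - (norm \<nu>)\<^sup>2 * hyp_fun h a ((norm \<nu>)\<^sup>2 * \<delta>\<^sup>2)" for \<nu> :: "real^'n"
  proof -
    have "(real CARD('n) + 2) / 2 = h + 1" "(real CARD('n) + 4 - \<beta>) / 2 = a + 1"
      by (auto simp: h_def a_def field_simps)
    then show ?thesis
      unfolding multiplier_def Let_def
      by (simp only: mult.assoc a_def[symmetric] hyp2F3_eq_hyp_fun[symmetric])
  qed
  obtain w0 c C where w0: "w0 > 0" "c > 0"
    and lower: "\<And>w. w \<ge> w0 \<Longrightarrow> c \<le> w powr a * hyp_fun h a w"
    and upper: "\<And>w. w \<ge> w0 \<Longrightarrow> w powr a * hyp_fun h a w \<le> C"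
    using hyp_fun_bounds[OF h a] by metis
  \<comment> \<open>The entry 1 makes \<open>1 + q\<close> and \<open>q\<close> comparable for
    \<open>q = (norm \<nu>)\<^sup>2\<close>; the other one puts \<open>w\<close> beyond
    \<open>w0\<close>. Below, \<open>d\<close> cancels the power of \<open>\<delta>\<close> in
    \<open>w powr a\<close>.\<close>
  define R where "R = max 1 (sqrt w0 / \<delta>)"
  define d where "d = \<delta>\<^sup>2 powr (- a)"
  have d: "d > 0"
    using assms(1) by (simp add: d_def)
  have key: "c * d * 2 powr (- s) * (1 + (norm \<nu>)\<^sup>2) powr s \<le> \<bar>multiplier \<delta> \<beta> \<nu>\<bar> \<and>
      \<bar>multiplier \<delta> \<beta> \<nu>\<bar> \<le> C * d * (1 + (norm \<nu>)\<^sup>2) powr s"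
    if "norm \<nu> \<ge> R" for \<nu> :: "real^'n"
  proof -
    define q where "q = (norm \<nu>)\<^sup>2"
    define K where "K = (q * \<delta>\<^sup>2) powr a * hyp_fun h a (q * \<delta>\<^sup>2)"
    have "norm \<nu> \<ge> 1" "sqrt w0 \<le> norm \<nu> * \<delta>"
      using that assms(1) by (auto simp: R_def divide_le_eq)
    then have q: "q \<ge> 1" and "(sqrt w0)\<^sup>2 \<le> (norm \<nu> * \<delta>)\<^sup>2"
      using w0(1) unfolding q_def by (simp, intro power_mono) auto
    then have w: "w0 \<le> q * \<delta>\<^sup>2"
      using w0(1) by (simp add: q_def power_mult_distrib)
    have K: "c \<le> K" "K \<le> C"
      using lower[OF w] upper[OF w] by (auto simp: K_def)
    have "q powr a \<noteq> 0" "\<delta>\<^sup>2 powr a \<noteq> 0" "q powr s = q / q powr a"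
      using q assms(1) by (auto simp: s_eq powr_diff)
    then have "(q * \<delta>\<^sup>2) powr a * d * q powr s = q"
      using q by (simp add: d_def powr_mult powr_minus)
    then have "multiplier \<delta> \<beta> \<nu> = - (K * d * q powr s)"
      unfolding mult K_def q_def[symmetric] by (simp add: mult_ac)
    then have abs: "\<bar>multiplier \<delta> \<beta> \<nu>\<bar> = K * d * q powr s"
      using K w0(2) d by (simp add: abs_mult)
    have "2 powr (- s) * (1 + q) powr s = ((1 + q) / 2) powr s"
      using q by (simp add: powr_divide powr_minus_divide)
    also have "\<dots> \<le> q powr s"
      using q s by (intro powr_mono2) auto
    finally have "c * d * (2 powr (- s) * (1 + q) powr s) \<le> K * d * q powr s"
      using K w0(2) d by (intro mult_mono mult_right_mono) auto
    moreover have "K * d * q powr s \<le> C * d * (1 + q) powr s"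
      using K w0(2) d q s by (intro mult_mono mult_right_mono powr_mono2) auto
    ultimately show ?thesis
      unfolding abs q_def[symmetric] by (simp add: mult.assoc)
  qed
  show ?thesis
    by (rule that[of "c * d * 2 powr (- s)" R "C * d"])
      (use key w0(2) d in \<open>auto simp: s_def[symmetric]\<close>)
qed

subsection \<open>Series of functions and lattice sums\<close>

lemma has_vector_derivative_iff_quotient:
  "(f has_vector_derivative D) (at x within S) \<longleftrightarrow>
    ((\<lambda>y. (f y - f x) /\<^sub>R (y - x)) \<longlongrightarrow> D) (at x within S)"
proof -
  have "norm (f y - f x - (y - x) *\<^sub>R D) / norm (y - x) = norm ((f y - f x) /\<^sub>R (y - x) - D)"
    if "y \<noteq> x" for y
  proof -
    have "f y - f x - (y - x) *\<^sub>R D = (y - x) *\<^sub>R ((f y - f x) /\<^sub>R (y - x) - D)"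
      using that by (simp add: scaleR_diff_right)
    then show ?thesis
      using that by simp
  qed
  then have "((\<lambda>y. norm (f y - f x - (y - x) *\<^sub>R D) / norm (y - x)) \<longlongrightarrow> 0) (at x within S) \<longleftrightarrow>
      ((\<lambda>y. norm ((f y - f x) /\<^sub>R (y - x) - D)) \<longlongrightarrow> 0) (at x within S)"
    by (intro filterlim_cong refl) (auto simp: eventually_at_filter)
  then show ?thesis
    unfolding has_vector_derivative_def has_derivative_iff_norm
    by (simp add: bounded_linear_scaleR_left tendsto_norm_zero_iff LIM_zero_iff)
qed

lemma summable_on_norm_comparison:
  fixes f :: "'a \<Rightarrow> 'b :: banach"
  assumes "M summable_on X" "\<And>k. k \<in> X \<Longrightarrow> norm (f k) \<le> M k"
  shows "f summable_on X"
  using Infinite_Sum.abs_summable_on_comparison_test'[OF assms] by (rule abs_summable_summable)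

text \<open>The mean value inequality on the convex set \<open>S\<close> bounds the difference
  quotients by \<open>M k\<close>. By the Weierstrass test their sum converges uniformly, and the
  limit \<open>s\<close> to \<open>t\<close> may be taken term by term.\<close>

lemma has_vector_derivative_infsum:
  fixes f f' :: "'a \<Rightarrow> real \<Rightarrow> 'b :: banach"
  assumes "convex S"
    and f': "\<And>k t. k \<in> X \<Longrightarrow> t \<in> S \<Longrightarrow> (f k has_vector_derivative f' k t) (at t within S)"
    and M: "\<And>k t. k \<in> X \<Longrightarrow> t \<in> S \<Longrightarrow> norm (f' k t) \<le> M k" "M summable_on X"
    and f: "\<And>t. t \<in> S \<Longrightarrow> (\<lambda>k. f k t) summable_on X"
    and t: "t \<in> S"
  shows "((\<lambda>t. \<Sum>\<^sub>\<infinity>k\<in>X. f k t) has_vector_derivative (\<Sum>\<^sub>\<infinity>k\<in>X. f' k t)) (at t within S)"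
proof -
  define q where "q k s = (f k s - f k t) /\<^sub>R (s - t)" for k s
  have "norm (q k s) \<le> M k" if "k \<in> X" "s \<in> S" for k s
  proof -
    have "norm (f k s - f k t) \<le> M k * norm (s - t)"
    proof (rule differentiable_bound[OF assms(1) _ _ \<open>s \<in> S\<close> t])
      fix u assume "u \<in> S"
      then show "(f k has_derivative (\<lambda>h. h *\<^sub>R f' k u)) (at u within S)"
        using f' \<open>k \<in> X\<close> by (simp add: has_vector_derivative_def)
      show "onorm (\<lambda>h. h *\<^sub>R f' k u) \<le> M k"
        using M(1)[OF \<open>k \<in> X\<close> \<open>u \<in> S\<close>]
        by (simp add: onorm_scaleR_left[OF bounded_linear_ident] onorm_id)
    qed
    moreover have "M k \<ge> 0"
      using M(1)[OF \<open>k \<in> X\<close> t] norm_ge_zero order_trans by blast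
    \<comment> \<open>At \<open>s = t\<close> the quotient is 0 by the convention for inverses, and
      the bound reduces to \<open>M k \<ge> 0\<close>.\<close>
    ultimately show ?thesis
      by (cases "s = t") (auto simp: q_def divide_simps)
  qed
  then have lim: "uniform_limit S (\<lambda>Y s. \<Sum>k\<in>Y. q k s) (\<lambda>s. \<Sum>\<^sub>\<infinity>k\<in>X. q k s) (finite_subsets_at_top X)"
    using M(2) by (rule Weierstrass_m_test_general)
  have "(\<lambda>k. f' k t) summable_on X"
    using M(2) M(1)[OF _ t] by (rule summable_on_norm_comparison)
  then have lim': "((\<lambda>Y. \<Sum>k\<in>Y. f' k t) \<longlongrightarrow> (\<Sum>\<^sub>\<infinity>k\<in>X. f' k t)) (finite_subsets_at_top X)"
    using has_sum_def has_sum_infsum by blast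
  have "\<forall>\<^sub>F Y in finite_subsets_at_top X. ((\<lambda>s. \<Sum>k\<in>Y. q k s) \<longlongrightarrow> (\<Sum>k\<in>Y. f' k t)) (at t within S)"
  proof (rule eventually_finite_subsets_at_top_weakI)
    fix Y assume "finite Y" "Y \<subseteq> X"
    then show "((\<lambda>s. \<Sum>k\<in>Y. q k s) \<longlongrightarrow> (\<Sum>k\<in>Y. f' k t)) (at t within S)"
      using f' t unfolding q_def has_vector_derivative_iff_quotient by (intro tendsto_sum) auto
  qed
  then have "((\<lambda>s. \<Sum>\<^sub>\<infinity>k\<in>X. q k s) \<longlongrightarrow> (\<Sum>\<^sub>\<infinity>k\<in>X. f' k t)) (at t within S)"
    using lim' lim finite_subsets_at_top_neq_bot by (rule swap_uniform_limit)
  moreover have "(\<Sum>\<^sub>\<infinity>k\<in>X. q k s) = ((\<Sum>\<^sub>\<infinity>k\<in>X. f k s) - (\<Sum>\<^sub>\<infinity>k\<in>X. f k t)) /\<^sub>R (s - t)" if "s \<in> S" for s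
    unfolding q_def infsum_scaleR_right
    using infsum_add[OF f[OF that] summable_on_uminus[THEN iffD2, OF f[OF t]]] by (simp add: infsum_uminus)
  then have "((\<lambda>s. \<Sum>\<^sub>\<infinity>k\<in>X. q k s) \<longlongrightarrow> (\<Sum>\<^sub>\<infinity>k\<in>X. f' k t)) (at t within S) \<longleftrightarrow>
      ((\<lambda>s. ((\<Sum>\<^sub>\<infinity>k\<in>X. f k s) - (\<Sum>\<^sub>\<infinity>k\<in>X. f k t)) /\<^sub>R (s - t)) \<longlongrightarrow> (\<Sum>\<^sub>\<infinity>k\<in>X. f' k t)) (at t within S)"
    by (intro filterlim_cong refl) (auto simp: eventually_at_filter)
  ultimately show ?thesis
    unfolding has_vector_derivative_iff_quotient by blast
qed

lemma continuous_on_infsum: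
  fixes f :: "'a \<Rightarrow> 'c::topological_space \<Rightarrow> 'b :: banach"
  assumes "\<And>k. k \<in> X \<Longrightarrow> continuous_on S (f k)"
    and "\<And>k t. k \<in> X \<Longrightarrow> t \<in> S \<Longrightarrow> norm (f k t) \<le> M k" "M summable_on X"
  shows "continuous_on S (\<lambda>t. \<Sum>\<^sub>\<infinity>k\<in>X. f k t)"
proof (rule uniform_limit_theorem)
  show "uniform_limit S (\<lambda>Y t. \<Sum>k\<in>Y. f k t) (\<lambda>t. \<Sum>\<^sub>\<infinity>k\<in>X. f k t) (finite_subsets_at_top X)"
    using assms(2,3) by (rule Weierstrass_m_test_general)
  show "\<forall>\<^sub>F Y in finite_subsets_at_top X. continuous_on S (\<lambda>t. \<Sum>k\<in>Y. f k t)"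
    using assms(1) by (intro eventually_finite_subsets_at_top_weakI continuous_on_sum) auto
qed simp

section \<open>Lattice sums\<close>

lemma summable_on_int_one_plus_square_powr:
  assumes "s > (1 / 2 :: real)"
  shows "(\<lambda>z::int. (1 + (real_of_int z)\<^sup>2) powr (- s)) summable_on UNIV"
proof -
  let ?f = "\<lambda>z::int. (1 + (real_of_int z)\<^sup>2) powr (- s)"
  have "summable (\<lambda>n::nat. (1 + (real n)\<^sup>2) powr (- s))"
  proof (rule summable_comparison_test')
    show "summable (\<lambda>n. real n powr (- 2 * s))"
      using assms by (subst summable_real_powr_iff) auto
    fix n :: nat assume n: "n \<ge> 1"
    then have "(1 + (real n)\<^sup>2) powr (- s) \<le> ((real n)\<^sup>2) powr (- s)"
      using assms by (intro powr_mono2') auto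
    also have "((real n)\<^sup>2) powr (- s) = real n powr (- 2 * s)"
      using n powr_powr[of "real n" 2 "- s"] by (simp add: powr_numeral)
    finally show "norm ((1 + (real n)\<^sup>2) powr (- s)) \<le> real n powr (- 2 * s)"
      by simp
  qed
  then have nat: "(\<lambda>n::nat. (1 + (real n)\<^sup>2) powr (- s)) summable_on UNIV"
    by (subst summable_on_UNIV_nonneg_real_iff) auto
  have "?f summable_on (int ` UNIV)"
    using nat by (subst summable_on_reindex) (auto simp: o_def inj_on_def)
  moreover have "?f summable_on ((\<lambda>n. - int n) ` UNIV)"
    using nat by (subst summable_on_reindex) (auto simp: o_def inj_on_def)
  moreover have "UNIV = int ` UNIV \<union> (\<lambda>n. - int n) ` UNIV"
    by (auto simp: image_iff) (metis int_cases2)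
  ultimately show ?thesis
    by (metis summable_on_union)
qed

lemma abs_real_vec_nth_le_norm: "\<bar>real_of_int (k $ i)\<bar> \<le> norm (real_vec k)"
  using component_le_norm_cart[of "real_vec k" i] by (simp add: real_vec_def)

text \<open>As \<open>1 + (norm k)\<^sup>2\<close> dominates \<open>1 + (k $ i)\<^sup>2\<close> for
  every \<open>i\<close>, the exponent can be shared equally among the coordinates. This leaves a
  product of one-dimensional sums with exponent \<open>s / n > 1 / 2\<close>.\<close>

lemma summable_on_lattice_one_plus_square_powr:
  fixes s :: real
  assumes "s > real CARD('n::finite) / 2"
  shows "(\<lambda>k::int^'n. (1 + (norm (real_vec k))\<^sup>2) powr (- s)) summable_on UNIV"
proof (rule nonneg_bdd_above_summable_on)
  define n where "n = real CARD('n)"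
  define \<phi> where "\<phi> z = (1 + (real_of_int z)\<^sup>2) powr (- (s / n))" for z :: int
  have n: "n > 0"
    by (simp add: n_def)
  have s: "s > 0"
    using assms by (meson less_trans of_nat_0_less_iff zero_less_card_finite half_gt_zero)
  have \<phi>: "\<phi> summable_on UNIV"
    unfolding \<phi>_def using assms n
    by (intro summable_on_int_one_plus_square_powr) (simp add: n_def field_simps)
  have N: "1 + (norm (real_vec k))\<^sup>2 > 0" for k :: "int^'n"
    by (simp add: add_pos_nonneg)
  have \<phi>_nonneg: "\<phi> z \<ge> 0" for z
    by (simp add: \<phi>_def)
  have le: "(1 + (norm (real_vec k))\<^sup>2) powr (- s) \<le> (\<Prod>i\<in>UNIV. \<phi> (k $ i))" for k :: "int^'n"
  proof -
    have "(1 + (norm (real_vec k))\<^sup>2) powr (- s) = ((1 + (norm (real_vec k))\<^sup>2) powr (- (s / n))) ^ CARD('n)"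
      using n N[of k] unfolding n_def
      by (subst powr_realpow[symmetric]) (auto simp: powr_powr)
    also have "\<dots> = (\<Prod>i\<in>(UNIV :: 'n set). (1 + (norm (real_vec k))\<^sup>2) powr (- (s / n)))"
      by simp
    also have "\<dots> \<le> (\<Prod>i\<in>UNIV. \<phi> (k $ i))"
    proof (rule prod_mono, safe)
      fix i
      have "(real_of_int (k $ i))\<^sup>2 \<le> (norm (real_vec k))\<^sup>2"
        using abs_real_vec_nth_le_norm[of k i] by (metis abs_le_square_iff abs_norm_cancel)
      then show "(1 + (norm (real_vec k))\<^sup>2) powr (- (s / n)) \<le> \<phi> (k $ i)"
        unfolding \<phi>_def using s n by (intro powr_mono2') (auto simp: add_pos_nonneg)
    qed simp
    finally show ?thesis .
  qed
  show "bdd_above (sum (\<lambda>k::int^'n. (1 + (norm (real_vec k))\<^sup>2) powr (- s)) ` {F. F \<subseteq> UNIV \<and> finite F})"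
  proof (rule bdd_aboveI2)
    fix F :: "(int^'n) set" assume "F \<in> {F. F \<subseteq> UNIV \<and> finite F}"
    then have F: "finite F"
      by simp
    \<comment> \<open>All coordinates of points of \<open>F\<close> lie in \<open>Z\<close>; over
      the full cube of functions into \<open>Z\<close> the sum factorises.\<close>
    define Z where "Z = (\<Union>i. (\<lambda>k. k $ i) ` F)"
    have Z: "finite Z"
      using F by (simp add: Z_def)
    have "(\<Sum>k\<in>F. (1 + (norm (real_vec k))\<^sup>2) powr (- s)) \<le> (\<Sum>k\<in>F. \<Prod>i\<in>UNIV. \<phi> (k $ i))"
      by (intro sum_mono le)
    also have "\<dots> = (\<Sum>g\<in>vec_nth ` F. \<Prod>i\<in>UNIV. \<phi> (g i))"
      by (subst sum.reindex) (auto simp: inj_on_def vec_nth_inject)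
    also have "\<dots> \<le> (\<Sum>g\<in>PiE (UNIV :: 'n set) (\<lambda>_. Z). \<Prod>i\<in>UNIV. \<phi> (g i))"
    proof (rule sum_mono2)
      show "finite (PiE (UNIV :: 'n set) (\<lambda>_. Z))"
        using Z by (intro finite_PiE) auto
      show "vec_nth ` F \<subseteq> PiE UNIV (\<lambda>_. Z)"
        by (auto simp: Z_def)
    qed (simp add: \<phi>_nonneg prod_nonneg)
    also have "\<dots> = (\<Prod>i\<in>(UNIV :: 'n set). \<Sum>z\<in>Z. \<phi> z)"
      using Z by (subst prod_sum_PiE) auto
    also have "\<dots> \<le> (\<Prod>i\<in>(UNIV :: 'n set). infsum \<phi> UNIV)"
      using Z \<phi>_nonneg \<phi> by (intro prod_mono conjI sum_nonneg finite_sum_le_infsum) auto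
    finally show "(\<Sum>k\<in>F. (1 + (norm (real_vec k))\<^sup>2) powr (- s)) \<le> (\<Prod>i\<in>(UNIV :: 'n set). infsum \<phi> UNIV)" .
  qed
qed simp

lemma finite_lattice_ball: "finite {k :: int^'n::finite. norm (real_vec k) < R}"
proof (rule finite_subset)
  show "{k :: int^'n. norm (real_vec k) < R} \<subseteq> {k. \<forall>i. k $ i \<in> {-\<lceil>R\<rceil>..\<lceil>R\<rceil>}}"
  proof safe
    fix k :: "int^'n" and i assume "norm (real_vec k) < R"
    then have "\<bar>real_of_int (k $ i)\<bar> < R"
      using abs_real_vec_nth_le_norm[of k i] by simp
    then show "k $ i \<in> {-\<lceil>R\<rceil>..\<lceil>R\<rceil>}"
      by (simp add: abs_less_iff) linarith
  qed
  show "finite {k :: int^'n. \<forall>i. k $ i \<in> {-\<lceil>R\<rceil>..\<lceil>R\<rceil>}}"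
  proof (rule finite_imageD)
    show "finite (vec_nth ` {k :: int^'n. \<forall>i. k $ i \<in> {-\<lceil>R\<rceil>..\<lceil>R\<rceil>}})"
      by (rule finite_subset[of _ "PiE UNIV (\<lambda>_. {-\<lceil>R\<rceil>..\<lceil>R\<rceil>})"]) (auto intro!: finite_PiE)
  qed (auto simp: inj_on_def vec_nth_inject)
qed

section \<open>Summability of the differentiated series\<close>

text \<open>A single term of a convergent nonnegative series is at most the sum.\<close>

lemma fourier_coeff_sobolev_bound:
  assumes "b \<in> sobolev_space \<sigma>"
  obtains B where "B \<ge> 0"
    "\<And>k. cmod (fourier_coeff b k) \<le> B * (1 + (norm (real_vec k))\<^sup>2) powr (- (\<sigma> / 2))"
proof -
  let ?N = "\<lambda>k. 1 + (norm (real_vec k))\<^sup>2"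
  let ?f = "\<lambda>k. ?N k powr \<sigma> * (cmod (fourier_coeff b k))\<^sup>2"
  have N: "?N k > 0" for k
    by (simp add: add_pos_nonneg)
  have sum: "?f summable_on UNIV"
    using assms by (simp add: sobolev_space_def)
  define B where "B = sqrt (infsum ?f UNIV)"
  have bound: "cmod (fourier_coeff b k) \<le> B * ?N k powr (- (\<sigma> / 2))" for k
  proof -
    have "?f k \<le> infsum ?f UNIV"
      using finite_sum_le_infsum[OF sum, of "{k}"] by simp
    moreover have "(?N k powr (\<sigma> / 2))\<^sup>2 = ?N k powr \<sigma>"
      using N[of k] by (simp add: powr_powr flip: powr_numeral)
    then have "?f k = (?N k powr (\<sigma> / 2) * cmod (fourier_coeff b k))\<^sup>2"
      by (simp add: power_mult_distrib)
    ultimately have "?N k powr (\<sigma> / 2) * cmod (fourier_coeff b k) \<le> B"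
      unfolding B_def by (intro real_le_rsqrt) simp
    then show ?thesis
      using N[of k] by (simp add: powr_minus field_simps)
  qed
  moreover have "B \<ge> 0"
    by (simp add: B_def infsum_nonneg)
  ultimately show ?thesis
    using that by blast
qed

text \<open>The terms are of order at most \<open>N k\<close> to the power
  \<open>s * e - \<sigma> / 2\<close>. Lattice summability asks for
  \<open>\<sigma> / 2 - s * e > n / 2\<close>, which is the condition on \<open>\<sigma>\<close>
  rewritten.\<close>

lemma summable_on_fourier_coeff_multiplier:
  fixes b :: "(real ^ 'n \<Rightarrow> complex) \<Rightarrow> complex" and \<delta> \<beta> \<sigma> :: real and j :: nat
  assumes "\<delta> > 0" "real CARD('n) < \<beta>" "\<beta> < real CARD('n) + 4"
    and b: "b \<in> sobolev_space \<sigma>"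
    and \<sigma>: "\<sigma> > real CARD('n) + (real j - 2) * ((\<beta> - real CARD('n)) / 2)"
  shows "(\<lambda>k. cmod (fourier_coeff b k) / \<bar>multiplier \<delta> \<beta> (real_vec k)\<bar> *
    sqrt \<bar>multiplier \<delta> \<beta> (real_vec k)\<bar> ^ j) summable_on UNIV"
proof -
  define s where "s = (\<beta> - real CARD('n)) / 2"
  define e where "e = real j / 2 - 1"
  define N where "N k = 1 + (norm (real_vec k))\<^sup>2" for k :: "int^'n"
  define m where "m k = \<bar>multiplier \<delta> \<beta> (real_vec k)\<bar>" for k :: "int^'n"
  let ?f = "\<lambda>k. cmod (fourier_coeff b k) / m k * sqrt (m k) ^ j"
  have N: "N k > 0" for k
    by (simp add: N_def add_pos_nonneg)
  obtain R c C where c: "c > 0"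
    and lower: "\<And>k. norm (real_vec k :: real^'n) \<ge> R \<Longrightarrow> c * N k powr s \<le> m k"
    and upper: "\<And>k. norm (real_vec k :: real^'n) \<ge> R \<Longrightarrow> m k \<le> C * N k powr s"
    using multiplier_bounds[OF assms(1-3)] unfolding N_def m_def s_def by metis
  obtain B where B: "B \<ge> 0" "\<And>k. cmod (fourier_coeff b k) \<le> B * N k powr (- (\<sigma> / 2))"
    using fourier_coeff_sobolev_bound[OF b] unfolding N_def by metis
  \<comment> \<open>The exponent \<open>e\<close> is negative for \<open>j < 2\<close>, where the
    lower bound on \<open>m k\<close> is used, and nonnegative otherwise, where the upper one
    is.\<close>
  define D where "D = max (c powr e) (C powr e)"
  have bound: "norm (?f k) \<le> B * D * N k powr (- (\<sigma> / 2 - s * e))" if k: "norm (real_vec k) \<ge> R" for k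
  proof -
    have cN: "c * N k powr s > 0"
      using c N[of k] by simp
    then have m: "m k > 0"
      using lower[OF k] by linarith
    then have C: "C > 0"
      using upper[OF k] N[of k] by (smt (verit) mult_nonpos_nonneg powr_ge_zero)
    have "sqrt (m k) ^ j = (m k powr (1 / 2)) powr real j"
      using m by (simp add: powr_half_sqrt powr_realpow)
    then have "sqrt (m k) ^ j / m k = m k powr e"
      using m by (simp add: powr_powr e_def powr_diff)
    moreover have "m k powr e \<le> D * (N k powr s) powr e"
    proof (cases "e \<ge> 0")
      case True
      then have "m k powr e \<le> (C * N k powr s) powr e"
        using upper[OF k] m by (intro powr_mono2) auto
      also have "\<dots> \<le> D * (N k powr s) powr e"
        using C by (simp add: powr_mult D_def mult_right_mono)
      finally show ?thesis .
    next
      case False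
      then have "m k powr e \<le> (c * N k powr s) powr e"
        using lower[OF k] cN by (intro powr_mono2') auto
      also have "\<dots> \<le> D * (N k powr s) powr e"
        using c by (simp add: powr_mult D_def mult_right_mono)
      finally show ?thesis .
    qed
    ultimately have "sqrt (m k) ^ j / m k \<le> D * N k powr (s * e)"
      by (simp add: powr_powr)
    then have "cmod (fourier_coeff b k) * (sqrt (m k) ^ j / m k)
        \<le> (B * N k powr (- (\<sigma> / 2))) * (D * N k powr (s * e))"
      using B m by (intro mult_mono) auto
    also have "\<dots> = B * D * N k powr (- (\<sigma> / 2 - s * e))"
      by (simp add: powr_add[symmetric] algebra_simps)
    finally show ?thesis
      using m by simp
  qed
  have "\<sigma> / 2 - s * e > real CARD('n) / 2"
    using \<sigma> unfolding s_def e_def by (simp add: field_simps)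
  then have "(\<lambda>k. N k powr (- (\<sigma> / 2 - s * e))) summable_on UNIV"
    unfolding N_def by (rule summable_on_lattice_one_plus_square_powr)
  then have "(\<lambda>k. B * D * N k powr (- (\<sigma> / 2 - s * e))) summable_on {k. norm (real_vec k) \<ge> R}"
    by (intro summable_on_cmult_right) (rule summable_on_subset_banach, auto)
  then have "?f summable_on {k. norm (real_vec k) \<ge> R}"
    by (rule summable_on_norm_comparison) (use bound in auto)
  \<comment> \<open>These finitely many terms need no estimate, even where the multiplier vanishes,
    as at \<open>k = 0\<close>.\<close>
  moreover have "?f summable_on {k. norm (real_vec k) < R}"
    by (intro summable_on_finite finite_lattice_ball)
  ultimately have "?f summable_on ({k. norm (real_vec k) \<ge> R} \<union> {k. norm (real_vec k) < R})"
    by (rule summable_on_union)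
  also have "{k :: int^'n. norm (real_vec k) \<ge> R} \<union> {k. norm (real_vec k) < R} = UNIV"
    by auto
  finally show ?thesis
    unfolding m_def .
qed

lemma norm_fourier_mode [simp]: "cmod (fourier_mode k x) = 1"
  by (simp add: fourier_mode_def)

text \<open>
  Since \<open>sqrt\<close> is odd, \<open>\<bar>sqrt (- m)\<bar> = sqrt \<bar>m\<bar>\<close> for either sign of \<open>m\<close>, so the sign of the
  multiplier plays no role.
\<close>

theorem theorem23:
  fixes \<delta> \<beta> \<sigma> :: real
    and b :: "(real ^ 'n \<Rightarrow> complex) \<Rightarrow> complex"
    and p :: nat
    and x :: "real ^ 'n"
  assumes "\<delta> > 0"
    and "real CARD('n) < \<beta>" and "\<beta> < real CARD('n) + 4"
    and "\<sigma> \<ge> 0" and "b \<in> sobolev_space \<sigma>"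
    and "\<sigma> > real CARD('n) + (real p - 2) * ((\<beta> - real CARD('n)) / 2)"
    and "x \<in> torus"
  shows "(\<forall>t\<ge>0. solution_term \<delta> \<beta> b x t summable_on {k. k \<noteq> 0}) \<and>
         Cp_on p {0..} (solution \<delta> \<beta> b x)"
proof -
  define m where "m k = multiplier \<delta> \<beta> (real_vec k)" for k :: "int^'n"
  define \<omega> where "\<omega> k = sqrt (- m k)" for k
  define A where "A j k = 2 * (cmod (fourier_coeff b k) / \<bar>m k\<bar> * sqrt \<bar>m k\<bar> ^ j)" for j k
  \<comment> \<open>The phase shift by \<open>j * pi / 2\<close> writes all derivatives of the
    cosine in one formula; the constant -1 survives only for \<open>j = 0\<close> and accounts for
    the factor 2 in \<open>A\<close>.\<close>
  define C where "C j k t = \<omega> k ^ j * cos (\<omega> k * t + real j * pi / 2) - (if j = 0 then 1 else 0)" for j k t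
  define T where "T j k t = fourier_coeff b k / complex_of_real (m k) * complex_of_real (C j k t) *
    fourier_mode k x" for j k t
  define Q :: "nat \<Rightarrow> real \<Rightarrow> real" where
    "Q j t = (if j = 0 then t\<^sup>2 / 2 else if j = 1 then t else if j = 2 then 1 else 0)" for j t
  define D where "D j t = fourier_coeff b 0 * complex_of_real (Q j t) +
    (\<Sum>\<^sub>\<infinity>k\<in>{k. k \<noteq> 0}. T j k t)" for j t
  have A: "A j summable_on {k. k \<noteq> 0}" if "j \<le> p" for j
  proof -
    \<comment> \<open>Since \<open>\<beta> > n\<close>, the condition for the top order
      \<open>p\<close> implies that for every lower order.\<close>
    have "(real j - 2) * ((\<beta> - real CARD('n)) / 2) \<le> (real p - 2) * ((\<beta> - real CARD('n)) / 2)"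
      using that assms by (intro mult_right_mono) auto
    then have "\<sigma> > real CARD('n) + (real j - 2) * ((\<beta> - real CARD('n)) / 2)"
      using assms(6) by linarith
    then have "A j summable_on UNIV"
      unfolding A_def m_def
      by (intro summable_on_cmult_right summable_on_fourier_coeff_multiplier[OF assms(1-3,5)])
    then show ?thesis
      by (rule summable_on_subset_banach) simp
  qed
  have T_le: "norm (T j k t) \<le> A j k" for j k t
  proof -
    have "\<bar>\<omega> k\<bar> = sqrt \<bar>m k\<bar>"
      by (simp add: \<omega>_def real_sqrt_abs' flip: real_sqrt_abs2)
    then have "\<bar>\<omega> k ^ j * cos (\<omega> k * t + real j * pi / 2)\<bar> \<le> sqrt \<bar>m k\<bar> ^ j * 1"
      unfolding abs_mult power_abs by (intro mult_mono) auto
    then have "\<bar>C j k t\<bar> \<le> 2 * sqrt \<bar>m k\<bar> ^ j"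
      unfolding C_def by (cases "j = 0") (auto simp: abs_le_iff)
    then have "cmod (fourier_coeff b k) / \<bar>m k\<bar> * \<bar>C j k t\<bar>
        \<le> cmod (fourier_coeff b k) / \<bar>m k\<bar> * (2 * sqrt \<bar>m k\<bar> ^ j)"
      by (intro mult_left_mono) auto
    then show ?thesis
      by (simp add: T_def A_def norm_mult norm_divide mult_ac)
  qed
  have T_summable: "(\<lambda>k. T j k t) summable_on {k. k \<noteq> 0}" if "j \<le> p" for j t
    using A[OF that] T_le by (rule summable_on_norm_comparison)
  have C_deriv: "(C j k has_real_derivative C (Suc j) k t) (at t within S)" for j k t S
  proof -
    have "cos (\<omega> k * t + real (Suc j) * pi / 2) = - sin (\<omega> k * t + real j * pi / 2)"
      using cos_add[of "\<omega> k * t + real j * pi / 2" "pi / 2"] by (simp add: field_simps)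
    then show ?thesis
      unfolding C_def[abs_def]
      by (auto intro!: derivative_eq_intros simp: algebra_simps)
  qed
  have T_deriv: "(T j k has_vector_derivative T (Suc j) k t) (at t within S)" for j k t S
    unfolding T_def[abs_def]
    by (intro has_vector_derivative_mult_left has_vector_derivative_mult_right
        has_vector_derivative_of_real) (use C_deriv in \<open>simp add: has_real_derivative_iff_has_vector_derivative\<close>)
  have Q_deriv: "(Q j has_real_derivative Q (Suc j) t) (at t within S)" for j t S
    unfolding Q_def[abs_def] by (auto intro!: derivative_eq_intros)
  have D_deriv: "(D j has_vector_derivative D (Suc j) t) (at t within {0..})"
    if "j < p" "t \<ge> 0" for j t
    unfolding D_def
    using that Q_deriv[of j t "{0..}"] T_le A[of "Suc j"] T_summable[of j]
    by (intro has_vector_derivative_add has_vector_derivative_mult_right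
        has_vector_derivative_of_real
        has_vector_derivative_infsum[where M = "A (Suc j)" and S = "{0..}"] T_deriv)
      (auto simp: has_real_derivative_iff_has_vector_derivative)
  have D_cont: "continuous_on {0..} (D j)" if "j \<le> p" for j
    unfolding D_def
  proof (intro continuous_on_add continuous_on_mult continuous_on_const continuous_on_of_real)
    show "continuous_on {0..} (Q j)"
      using Q_deriv by (rule DERIV_continuous_on)
    show "continuous_on {0..} (\<lambda>t. \<Sum>\<^sub>\<infinity>k\<in>{k. k \<noteq> 0}. T j k t)"
      using T_le A[OF that] T_deriv
      by (intro continuous_on_infsum[where M = "A j"] continuous_on_vector_derivative) auto
  qed
  have term_eq: "solution_term \<delta> \<beta> b x t = (\<lambda>k. T 0 k t)" for t
    by (simp add: fun_eq_iff solution_term_def T_def C_def \<omega>_def m_def Let_def)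
  have "Cp_on p {0..} (solution \<delta> \<beta> b x)"
    unfolding Cp_on_def
  proof (intro exI[of _ D] conjI ballI allI impI)
    show "D 0 t = solution \<delta> \<beta> b x t" for t
      by (simp add: D_def Q_def solution_def term_eq)
  qed (use D_deriv D_cont in auto)
  then show ?thesis
    using T_summable[of 0] by (simp add: term_eq)
qed

end
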